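(* Let $\mathcal{H}$ be a separable complex Hilbert space, and let $H_0$ and $V$ be self-adjoint operators in $\mathcal{H}$ such that $V(H_0 - z_0 I_{\mathcal{H}})^{-1}$ is a compact operator on $\mathcal{H}$ for some (and hence for all) $z_0 \in \rho(H_0)$. Fix $E_0 \in \mathbb{R} \cap \rho(H_0)$ and set $H_t = H_0 + tV$, $t \in [0,1]$. Then there exist at most finitely many $t \in [0,1]$ such that $E_0 \in \sigma_p(H_t)$.
   Context: $\rho(\cdot)$ denotes the resolvent set and $\sigma_p(\cdot)$ the point spectrum (the set of eigenvalues) of an operator in $\mathcal{H}$; $I_{\mathcal{H}}$ is the identity operator. The self-adjoint operators may be unbounded; compactness of $V(H_0 - z_0 I_{\mathcal{H}})^{-1}$ includes that this product is defined on all of $\mathcal{H}$, i.e. $\operatorname{dom}(H_0) \subseteq \operatorname{dom}(V)$. The operator $H_t = H_0 + tV$ has domain $\operatorname{dom}(H_t) = \operatorname{dom}(H_0)$ for all $t\in[0,1]$. *)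

theory Defs
  imports "HOL-Analysis.Analysis"
begin

section \<open>Complex Hilbert spaces\<close>

class complex_vector = real_vector +
  fixes scaleC :: "complex \<Rightarrow> 'a \<Rightarrow> 'a"  (infixr "*\<^sub>C" 75)
  assumes scaleC_add_right: "a *\<^sub>C (x + y) = a *\<^sub>C x + a *\<^sub>C y"
    and scaleC_add_left: "(a + b) *\<^sub>C x = a *\<^sub>C x + b *\<^sub>C x"
    and scaleC_scaleC: "a *\<^sub>C b *\<^sub>C x = (a * b) *\<^sub>C x"
    and scaleR_scaleC: "r *\<^sub>R x = complex_of_real r *\<^sub>C x"

text \<open>
  The complex inner product is antilinear in its first and linear in its second argument.
  Its real part is the inner product of \<^class>\<open>real_inner\<close>, so the norm
  and the topology of the class are the ones it induces; positive definiteness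
  is inherited from \<^class>\<open>real_inner\<close>.
\<close>

class complex_hilbert = complex_vector + real_inner + complete_space +
  fixes cinner :: "'a \<Rightarrow> 'a \<Rightarrow> complex"
  assumes cinner_commute: "cinner x y = cnj (cinner y x)"
    and cinner_add_right: "cinner x (y + z) = cinner x y + cinner x z"
    and cinner_scaleC_right: "cinner x (a *\<^sub>C y) = a * cinner x y"
    and inner_eq_Re_cinner: "inner x y = Re (cinner x y)"

instantiation complex :: complex_hilbert
begin

definition scaleC_complex :: "complex \<Rightarrow> complex \<Rightarrow> complex"
  where "scaleC_complex a x = a * x"

definition cinner_complex :: "complex \<Rightarrow> complex \<Rightarrow> complex"
  where "cinner_complex x y = cnj x * y"

instance
  by standard
    (simp_all add: scaleC_complex_def cinner_complex_def algebra_simps inner_complex_def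
      scaleR_conv_of_real)

end


section \<open>Unbounded operators\<close>

text \<open>
  A not necessarily everywhere defined operator \<open>T\<close> is a partial map with domain
  \<^term>\<open>dom T\<close>. Equality of such maps is equality of operators, including
  equality of their domains.
\<close>

type_synonym 'a operator = "'a \<rightharpoonup> 'a"

definition linear_operator :: "'a::complex_vector operator \<Rightarrow> bool" where
  "linear_operator T \<longleftrightarrow>
     T 0 = Some 0 \<and>
     (\<forall>x y u v. T x = Some u \<longrightarrow> T y = Some v \<longrightarrow> T (x + y) = Some (u + v)) \<and>
     (\<forall>c x u. T x = Some u \<longrightarrow> T (c *\<^sub>C x) = Some (c *\<^sub>C u))"

definition bounded_operator :: "'a::complex_hilbert operator \<Rightarrow> bool" where
  "bounded_operator T \<longleftrightarrow> linear_operator T \<and> dom T = UNIV \<and>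
     (\<exists>K. \<forall>x. norm (the (T x)) \<le> K * norm x)"

definition compact_operator :: "'a::complex_hilbert operator \<Rightarrow> bool" where
  "compact_operator T \<longleftrightarrow> linear_operator T \<and> dom T = UNIV \<and>
     (\<forall>B. bounded B \<longrightarrow> compact (closure ((\<lambda>x. the (T x)) ` B)))"

definition op_id :: "'a operator" where
  "op_id = Some"

definition op_add :: "'a::complex_vector operator \<Rightarrow> 'a operator \<Rightarrow> 'a operator" where
  "op_add S T = (\<lambda>x. if x \<in> dom S \<inter> dom T then Some (the (S x) + the (T x)) else None)"

text \<open>Scaling by \<open>0\<close> keeps the domain.\<close>

definition op_scale :: "complex \<Rightarrow> 'a::complex_vector operator \<Rightarrow> 'a operator" where
  "op_scale c T = (\<lambda>x. map_option (scaleC c) (T x))"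

text \<open>
  For injective \<open>T\<close> this is the inverse operator, with domain
  \<^term>\<open>ran T\<close>.
\<close>

definition op_inverse :: "'a operator \<Rightarrow> 'a operator" where
  "op_inverse T = (\<lambda>y. if \<exists>!x. T x = Some y then Some (THE x. T x = Some y) else None)"

text \<open>
  Meaningful for densely defined \<open>T\<close>, where the vector \<open>w\<close> below is
  unique whenever it exists.
\<close>

definition adjoint_op :: "'a::complex_hilbert operator \<Rightarrow> 'a operator" where
  "adjoint_op T = (\<lambda>y.
     if \<exists>w. \<forall>x\<in>dom T. cinner y (the (T x)) = cinner w x
     then Some (THE w. \<forall>x\<in>dom T. cinner y (the (T x)) = cinner w x)
     else None)"

definition selfadjoint_op :: "'a::complex_hilbert operator \<Rightarrow> bool" where
  "selfadjoint_op T \<longleftrightarrow> linear_operator T \<and> closure (dom T) = UNIV \<and> adjoint_op T = T"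


section \<open>Resolvent and spectrum\<close>

definition op_shift :: "'a::complex_vector operator \<Rightarrow> complex \<Rightarrow> 'a operator" where
  "op_shift T z = op_add T (op_scale (- z) op_id)"

definition resolvent :: "'a::complex_vector operator \<Rightarrow> complex \<Rightarrow> 'a operator" where
  "resolvent T z = op_inverse (op_shift T z)"

definition resolvent_set :: "'a::complex_hilbert operator \<Rightarrow> complex set" where
  "resolvent_set T =
     {z. inj_on (op_shift T z) (dom T) \<and> ran (op_shift T z) = UNIV \<and>
         bounded_operator (resolvent T z)}"

definition point_spectrum :: "'a::complex_vector operator \<Rightarrow> complex set" where
  "point_spectrum T = {z. \<exists>x. x \<noteq> 0 \<and> T x = Some (z *\<^sub>C x)}"

end

theory Submission
  imports Defs
begin

text \<open>
  Write \<open>R\<close> for the resolvent of \<open>H\<^sub>0\<close> at \<open>E\<^sub>0\<close>. The resolvent identity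
  \<open>V R = V (H\<^sub>0 - z\<^sub>0)\<^sup>-\<^sup>1 (I + (E\<^sub>0 - z\<^sub>0) R)\<close> shows that \<open>V R\<close> is compact. If
  \<open>(H\<^sub>0 + t V) x = E\<^sub>0 x\<close> with \<open>x \<noteq> 0\<close>, then \<open>y = (H\<^sub>0 - E\<^sub>0) x\<close> is nonzero and
  \<open>y = - t V R y\<close>, so \<open>- 1 / t\<close> is an eigenvalue of \<open>V R\<close> of modulus at least 1. By the
  Riesz argument a compact operator has only finitely many of these. All eigenvalues
  concerned are real, so the whole argument takes place in the underlying real inner product
  space.
\<close>

section \<open>Eigenvalues of compact linear maps\<close>

text \<open>One Gram-Schmidt step per generator: \<open>c - q\<close> is the part of the new
  generator \<open>c\<close> orthogonal to \<open>span B\<close>, and the component of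
  \<open>a\<close> along it is added to the projection already found.\<close>

lemma orthogonal_projection_span_exists:
  fixes a :: "'a::real_inner"
  assumes "finite B"
  shows "\<exists>p\<in>span B. \<forall>b\<in>span B. (a - p) \<bullet> b = 0"
  using assms
proof (induction arbitrary: a)
  case empty
  then show ?case by simp
next
  case (insert c B)
  obtain p where p: "p \<in> span B" "\<And>b. b \<in> span B \<Longrightarrow> (a - p) \<bullet> b = 0"
    using insert.IH[of a] by blast
  obtain q where q: "q \<in> span B" "\<And>b. b \<in> span B \<Longrightarrow> (c - q) \<bullet> b = 0"
    using insert.IH[of c] by blast
  \<comment> \<open>If \<open>c\<close> already lies in \<open>span B\<close>, then
    \<open>c = q\<close>; the quotient is 0 by the convention for division by 0, and
    \<open>r = p\<close> remains correct.\<close>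
  define k where "k = ((a - p) \<bullet> (c - q)) / ((c - q) \<bullet> (c - q))"
  define r where "r = p + k *\<^sub>R (c - q)"
  have mono: "x \<in> span (insert c B)" if "x \<in> span B" for x
    using that span_mono[of B "insert c B"] by blast
  have "c \<in> span (insert c B)"
    by (simp add: span_base)
  then have "r \<in> span (insert c B)"
    using mono[OF p(1)] mono[OF q(1)] unfolding r_def by (intro span_add span_scale span_diff)
  moreover have "(a - r) \<bullet> b = 0" if b: "b \<in> span (insert c B)" for b
  proof -
    obtain m where m: "b - m *\<^sub>R c \<in> span B"
      using b span_breakdown_eq by blast
    define s where "s = b - m *\<^sub>R c + m *\<^sub>R q"
    have s: "s \<in> span B" "b = m *\<^sub>R (c - q) + s"
      unfolding s_def using m q(1) by (auto intro: span_add span_scale simp: scaleR_diff_right)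
    have "(a - r) \<bullet> (c - q) = (a - p) \<bullet> (c - q) - k * ((c - q) \<bullet> (c - q))"
      by (simp add: r_def inner_diff_left inner_add_left)
    also have "\<dots> = 0"
      unfolding k_def by (cases "c = q") auto
    finally have "(a - r) \<bullet> (c - q) = 0" .
    moreover have "(a - r) \<bullet> s = 0"
      using p(2)[OF s(1)] q(2)[OF s(1)]
      by (simp add: r_def inner_diff_left inner_add_left)
    ultimately show ?thesis
      by (simp add: s(2) inner_add_right)
  qed
  ultimately show ?case by blast
qed

text \<open>\<open>K - l j\<close> annihilates \<open>y j\<close> and multiplies every other
  \<open>y i\<close> by \<open>l i - l j\<close>, so \<open>y j\<close> drops out of the
  span.\<close>

lemma linear_shift_eigenvectors_span:
  fixes K :: "'a::real_vector \<Rightarrow> 'a"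
  assumes K: "linear K" and eig: "\<And>i. i \<in> insert j I \<Longrightarrow> K (y i) = l i *\<^sub>R y i"
    and v: "v \<in> span (y ` insert j I)"
  shows "K v - l j *\<^sub>R v \<in> span (y ` I)"
proof -
  interpret K: linear K by (rule K)
  have lin: "linear (\<lambda>v. K v - l j *\<^sub>R v)"
    by (rule linearI) (simp_all add: K.add K.scale algebra_simps)
  have "(\<lambda>v. K v - l j *\<^sub>R v) ` (y ` insert j I) \<subseteq> span (y ` I)"
  proof clarify
    fix i assume i: "i \<in> insert j I"
    show "K (y i) - l j *\<^sub>R y i \<in> span (y ` I)"
    proof (cases "i = j")
      case True
      then show ?thesis using eig[of j] by (simp add: span_zero)
    next
      case False
      then have "(l i - l j) *\<^sub>R y i \<in> span (y ` I)"
        using i by (intro span_scale span_base) auto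
      then show ?thesis by (simp add: eig[OF i] scaleR_diff_left)
    qed
  qed
  then have "span ((\<lambda>v. K v - l j *\<^sub>R v) ` (y ` insert j I)) \<subseteq> span (y ` I)"
    by (simp add: span_minimal)
  then show ?thesis
    using v unfolding linear_span_image[OF lin] by blast
qed

lemma linear_maps_eigenvectors_span:
  fixes K :: "'a::real_vector \<Rightarrow> 'a"
  assumes K: "linear K" and eig: "\<And>i. i \<in> I \<Longrightarrow> K (y i) = l i *\<^sub>R y i"
    and v: "v \<in> span (y ` I)"
  shows "K v \<in> span (y ` I)"
proof -
  have "K (y i) \<in> span (y ` I)" if "i \<in> I" for i
    using that by (simp add: eig span_scale span_base)
  then have "K ` (y ` I) \<subseteq> span (y ` I)"
    by blast
  then have "K ` span (y ` I) \<subseteq> span (y ` I)"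
    by (simp flip: linear_span_image[OF K] add: span_minimal)
  then show ?thesis using v by blast
qed

text \<open>On \<open>v\<close> the map \<open>K - l j\<close> is multiplication by the nonzero
  number \<open>m - l j\<close>, while it also removes \<open>y j\<close> from the span. Hence
  \<open>v\<close> lies in the smaller span, and the induction ends at the zero space.\<close>

lemma eigenvector_in_span_eq_zero:
  fixes K :: "'a::real_vector \<Rightarrow> 'a"
  assumes K: "linear K" and "finite I" and "\<And>i. i \<in> I \<Longrightarrow> K (y i) = l i *\<^sub>R y i"
    and "\<And>i. i \<in> I \<Longrightarrow> l i \<noteq> m" and "v \<in> span (y ` I)" and "K v = m *\<^sub>R v"
  shows "v = 0"
  using assms(2-)
proof (induction I)
  case empty
  then show ?case by simp
next
  case (insert j I)
  have "K v - l j *\<^sub>R v \<in> span (y ` I)"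
    by (rule linear_shift_eigenvectors_span[OF K]) (fact insert.prems)+
  then have "(m - l j) *\<^sub>R v \<in> span (y ` I)"
    by (simp add: insert.prems(4) scaleR_diff_left)
  then have "inverse (m - l j) *\<^sub>R (m - l j) *\<^sub>R v \<in> span (y ` I)"
    by (rule span_scale)
  then have "v \<in> span (y ` I)"
    using insert.prems(2)[of j] by simp
  then show ?case
    by (intro insert.IH) (simp_all add: insert.prems)
qed

text \<open>Infinitely many such eigenvalues would yield unit vectors whose images under
  \<open>K\<close> are pairwise at distance at least \<open>r\<close>, so that no subsequence of the
  images converges.\<close>

lemma finite_large_eigenvalues_of_compact:
  fixes K :: "'a::real_inner \<Rightarrow> 'a"
  assumes K: "linear K" and comp: "compact (closure (K ` cball 0 1))" and "r > 0"
  shows "finite {l. r \<le> \<bar>l\<bar> \<and> (\<exists>v. v \<noteq> 0 \<and> K v = l *\<^sub>R v)}" (is "finite ?L")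
proof (rule ccontr)
  assume "infinite ?L"
  from infinite_countable_subset[OF this]
  obtain l :: "nat \<Rightarrow> real" where l: "inj l" "range l \<subseteq> ?L"
    by (elim exE conjE)
  have l_in: "l n \<in> ?L" for n
    using l(2) by (rule subsetD) simp
  then have large: "r \<le> \<bar>l n\<bar>" for n
    by simp
  have "\<forall>n. \<exists>v. v \<noteq> 0 \<and> K v = l n *\<^sub>R v"
    using l_in by simp
  then obtain y where y: "\<And>n. y n \<noteq> 0" "\<And>n. K (y n) = l n *\<^sub>R y n"
    by metis
  \<comment> \<open>An increasing chain of \<open>K\<close>-invariant subspaces with
    \<open>M 0 = {0}\<close>; it is strict because \<open>y n\<close> is an eigenvector for an
    eigenvalue different from the earlier ones.\<close>
  define M where "M n = span (y ` {..<n})" for n :: nat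
  have "\<exists>p\<in>M n. \<forall>b\<in>M n. (y n - p) \<bullet> b = 0" for n
    unfolding M_def by (rule orthogonal_projection_span_exists) simp
  then obtain p where p: "\<And>n. p n \<in> M n" "\<And>n b. b \<in> M n \<Longrightarrow> (y n - p n) \<bullet> b = 0"
    by metis
  have y_notin: "y n \<notin> M n" for n
    using eigenvector_in_span_eq_zero[OF K, of "{..<n}" y l "l n" "y n"] y
    unfolding M_def by (auto simp: inj_eq[OF l(1)])
  have nz: "y n - p n \<noteq> 0" for n
    using y_notin[of n] p(1)[of n] by auto
  \<comment> \<open>A unit vector of \<open>M (Suc n)\<close> orthogonal to \<open>M n\<close>; the
    inner product gives exact orthogonality where Riesz's lemma in a normed space gives an
    approximate one.\<close>
  define w where "w n = (y n - p n) /\<^sub>R norm (y n - p n)" for n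
  have norm_w: "norm (w n) = 1" for n
    using nz[of n] by (simp add: w_def)
  have orth: "w n \<bullet> b = 0" if "b \<in> M n" for n b
    using p(2)[OF that] by (simp add: w_def)
  have M_mono: "M m \<subseteq> M n" if "m \<le> n" for m n
    unfolding M_def using that by (intro span_mono image_mono) auto
  have w_in: "w n \<in> M (Suc n)" for n
  proof -
    have "p n \<in> M (Suc n)" "y n \<in> M (Suc n)"
      using M_mono[of n "Suc n"] p(1) by (auto simp: M_def intro: span_base)
    then show ?thesis
      unfolding w_def M_def by (intro span_scale span_diff)
  qed
  have Kw: "K (w n) \<in> M (Suc n)" for n
    using linear_maps_eigenvectors_span[OF K, of "{..<Suc n}" y l] y(2) w_in[of n]
    unfolding M_def by blast
  have Kw_shift: "K (w n) - l n *\<^sub>R w n \<in> M n" for n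
    using linear_shift_eigenvectors_span[OF K, of n "{..<n}" y l "w n"] y(2) w_in[of n]
    unfolding M_def lessThan_Suc by blast
  have sep: "r \<le> dist (K (w n)) (K (w m))" if "m < n" for m n
  proof -
    \<comment> \<open>\<open>K (w n) - K (w m)\<close> equals \<open>l n *\<^sub>R w n + b\<close>
      with \<open>b\<close> in \<open>M n\<close>, so pairing with \<open>w n\<close> isolates
      \<open>l n\<close>, and Cauchy-Schwarz bounds the distance below by its modulus.\<close>
    define b where "b = K (w n) - l n *\<^sub>R w n - K (w m)"
    have "K (w m) \<in> M n"
      using Kw[of m] M_mono[of "Suc m" n] that by auto
    with Kw_shift[of n] have "b \<in> M n"
      unfolding b_def M_def by (rule span_diff)
    then have "w n \<bullet> (K (w n) - K (w m)) = l n * (w n \<bullet> w n)"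
      using orth[of b n] by (simp add: b_def inner_diff_right)
    also have "\<dots> = l n"
      using norm_w[of n] by (simp add: norm_eq_1)
    finally have "\<bar>l n\<bar> \<le> norm (K (w n) - K (w m))"
      using Cauchy_Schwarz_ineq2[of "w n" "K (w n) - K (w m)"] norm_w[of n] by simp
    then show ?thesis
      using large[of n] by (simp add: dist_norm)
  qed
  have "K (w n) \<in> closure (K ` cball 0 1)" for n
    using norm_w[of n] by (intro subsetD[OF closure_subset] imageI) simp
  then obtain a s where s: "strict_mono s" "((\<lambda>n. K (w n)) \<circ> s) \<longlonglongrightarrow> a"
    using comp[unfolded compact_def, rule_format, of "\<lambda>n. K (w n)"] by blast
  then have "Cauchy ((\<lambda>n. K (w n)) \<circ> s)"
    by (simp add: LIMSEQ_imp_Cauchy)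
  then obtain N where "\<And>m n. m \<ge> N \<Longrightarrow> n \<ge> N \<Longrightarrow> dist (K (w (s m))) (K (w (s n))) < r"
    using \<open>r > 0\<close> unfolding Cauchy_def comp_def by metis
  then have "dist (K (w (s (Suc N)))) (K (w (s N))) < r"
    by simp
  moreover have "s N < s (Suc N)"
    using s(1) by (simp add: strict_mono_def)
  ultimately show False
    using sep by fastforce
qed

section \<open>Complex scalars and resolvents\<close>

lemma scaleC_zero_left [simp]: "0 *\<^sub>C x = (0 :: 'a::complex_vector)"
  using scaleR_scaleC[of 0 x] by simp

lemma scaleC_minus_left [simp]: "(- a) *\<^sub>C x = - (a *\<^sub>C (x :: 'a::complex_vector))"
  using scaleC_add_left[of "- a" a x] by (simp add: add_eq_0_iff2)

lemma scaleC_diff_left: "(a - b) *\<^sub>C x = a *\<^sub>C x - b *\<^sub>C (x :: 'a::complex_vector)"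
  using scaleC_add_left[of a "- b" x] by simp

text \<open>The norm is tied to complex scalars only through \<open>cinner\<close>, so the squared
  norm is computed as the real part of \<open>cinner\<close> on the diagonal.\<close>

lemma norm_scaleC: "norm (a *\<^sub>C x) = cmod a * norm (x :: 'a::complex_hilbert)"
proof -
  have "cinner (a *\<^sub>C x) x = cnj (a * cinner x x)"
    by (metis cinner_commute cinner_scaleC_right)
  then have "cinner (a *\<^sub>C x) (a *\<^sub>C x) = (a * cnj a) * cnj (cinner x x)"
    by (simp add: cinner_scaleC_right)
  also have "cnj (cinner x x) = cinner x x"
    by (metis cinner_commute)
  finally have "Re (cinner (a *\<^sub>C x) (a *\<^sub>C x)) = (cmod a)\<^sup>2 * Re (cinner x x)"
    by (simp add: complex_mult_cnj cmod_power2 flip: of_real_power of_real_add)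
  then have "(norm (a *\<^sub>C x))\<^sup>2 = (cmod a * norm x)\<^sup>2"
    by (simp add: power_mult_distrib power2_norm_eq_inner inner_eq_Re_cinner)
  then show ?thesis by simp
qed

lemma linear_operator_imp_linear:
  assumes "linear_operator T" and "dom T = UNIV"
  shows "linear (\<lambda>x. the (T x))"
proof (rule linearI)
  have T: "T x = Some (the (T x))" for x
    using assms(2) by (metis UNIV_I domD option.sel)
  show "the (T (x + y)) = the (T x) + the (T y)" for x y
    using assms(1) T[of x] T[of y] unfolding linear_operator_def by (metis option.sel)
  show "the (T (c *\<^sub>R x)) = c *\<^sub>R the (T x)" for c x
    using assms(1) T[of x] unfolding linear_operator_def scaleR_scaleC by (metis option.sel)
qed

lemma op_shift_Some:
  "T x = Some u \<Longrightarrow> op_shift T z x = Some (u - z *\<^sub>C (x :: 'a::complex_vector))"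
  by (auto simp: op_shift_def op_add_def op_scale_def op_id_def)

text \<open>This evaluates a resolvent at a vector already written as \<open>(T - z) x\<close>;
  injectivity supplies the unique preimage that \<open>op_inverse\<close> asks for.\<close>

lemma resolvent_shift:
  assumes z: "z \<in> resolvent_set T" and T: "T x = Some u"
  shows "resolvent T z (u - z *\<^sub>C x) = Some x"
proof -
  have eq: "op_shift T z x = Some (u - z *\<^sub>C x)"
    using T by (rule op_shift_Some)
  have uniq: "v = x" if v: "op_shift T z v = Some (u - z *\<^sub>C x)" for v
  proof (rule inj_onD)
    show "inj_on (op_shift T z) (dom T)"
      using z by (simp add: resolvent_set_def)
    show "op_shift T z v = op_shift T z x"
      by (simp only: eq v)
    show "v \<in> dom T"
      using v by (auto simp: op_shift_def op_add_def split: if_splits)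
    show "x \<in> dom T"
      using T by blast
  qed
  then have "(THE v. op_shift T z v = Some (u - z *\<^sub>C x)) = x"
    using eq by (intro the_equality)
  moreover have "\<exists>!v. op_shift T z v = Some (u - z *\<^sub>C x)"
    using eq uniq by (rule ex1I)
  ultimately show ?thesis
    by (simp add: resolvent_def op_inverse_def)
qed

theorem lemma2p3:
  fixes H0 V :: "'a::complex_hilbert operator" and E0 :: real
  assumes "separable_space (euclidean :: 'a topology)"
    and "selfadjoint_op H0" and "selfadjoint_op V"
    and "\<exists>z0 \<in> resolvent_set H0. compact_operator (V \<circ>\<^sub>m resolvent H0 z0)"
    and "complex_of_real E0 \<in> resolvent_set H0"
  shows "finite {t :: real. 0 \<le> t \<and> t \<le> 1 \<and>
    complex_of_real E0 \<in> point_spectrum (op_add H0 (op_scale (complex_of_real t) V))}"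
proof -
  obtain z where z: "z \<in> resolvent_set H0" and comp: "compact_operator (V \<circ>\<^sub>m resolvent H0 z)"
    using assms(4) by blast
  define e where "e = complex_of_real E0"
  have e: "e \<in> resolvent_set H0" using assms(5) by (simp add: e_def)
  define R where "R y = the (resolvent H0 e y)" for y
  define K0 where "K0 y = the ((V \<circ>\<^sub>m resolvent H0 z) y)" for y
  \<comment> \<open>\<open>S\<close> is \<open>I + (e - z) R\<close>, which sends
    \<open>(H0 - e) x\<close> to \<open>(H0 - z) x\<close>. Therefore \<open>K\<close>, built from
    the compact \<open>K0\<close>, represents \<open>V R\<close>.\<close>
  define S where "S y = y + (e - z) *\<^sub>C R y" for y
  define K where "K y = K0 (S y)" for y
  have bR: "bounded_operator (resolvent H0 e)"
    using e by (simp add: resolvent_set_def)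
  then have linR: "linear R"
    unfolding R_def bounded_operator_def by (blast intro: linear_operator_imp_linear)
  obtain C where C: "\<And>y. norm (R y) \<le> C * norm y"
    using bR unfolding R_def bounded_operator_def by blast
  have linS: "linear S"
  proof (rule linearI)
    show "S (x + y) = S x + S y" for x y
      by (simp add: S_def linear_add[OF linR] scaleC_add_right)
    show "S (c *\<^sub>R x) = c *\<^sub>R S x" for c x
      by (simp add: S_def linear_scale[OF linR] scaleR_add_right)
         (simp add: scaleR_scaleC scaleC_scaleC mult.commute)
  qed
  have linK0: "linear K0"
    using comp unfolding K0_def compact_operator_def by (blast intro: linear_operator_imp_linear)
  have linK: "linear K"
    unfolding K_def using linear_compose[OF linS linK0] by (simp add: comp_def)
  \<comment> \<open>Boundedness of \<open>S\<close> on the unit ball carries compactness from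
    \<open>K0\<close> over to \<open>K\<close>. The absolute value is taken because \<open>C\<close>
    may be negative when the space is trivial.\<close>
  have "norm (S y) \<le> 1 + cmod (e - z) * \<bar>C\<bar>" if "y \<in> cball 0 1" for y
  proof -
    have "norm (R y) \<le> \<bar>C\<bar> * norm y"
      using C[of y] mult_right_mono[OF abs_ge_self[of C] norm_ge_zero[of y]] by linarith
    also have "\<dots> \<le> \<bar>C\<bar>"
      using that by (simp add: mult_left_le)
    finally have "cmod (e - z) * norm (R y) \<le> cmod (e - z) * \<bar>C\<bar>"
      by (simp add: mult_left_mono)
    then show ?thesis
      using norm_triangle_ineq[of y "(e - z) *\<^sub>C R y"] that by (simp add: S_def norm_scaleC)
  qed
  then have "bounded (S ` cball 0 1)"
    unfolding bounded_iff by blast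
  then have "compact (closure (K0 ` S ` cball 0 1))"
    using comp unfolding compact_operator_def K0_def by blast
  then have compK: "compact (closure (K ` cball 0 1))"
    unfolding K_def by (simp add: image_image)
  have eig: "t \<noteq> 0 \<and> (\<exists>y. y \<noteq> 0 \<and> K y = (- 1 / t) *\<^sub>R y)"
    if t: "e \<in> point_spectrum (op_add H0 (op_scale (complex_of_real t) V))" for t
  proof -
    obtain x where x: "x \<noteq> 0" "op_add H0 (op_scale (complex_of_real t) V) x = Some (e *\<^sub>C x)"
      using t unfolding point_spectrum_def by blast
    then have "x \<in> dom H0" and "x \<in> dom V"
      by (auto simp: op_add_def op_scale_def split: if_splits)
    then obtain u v where u: "H0 x = Some u" and v: "V x = Some v"
      by blast
    have uv: "u + t *\<^sub>R v = e *\<^sub>C x"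
      using x(2) by (simp add: op_add_def op_scale_def scaleR_scaleC u v dom_def)
    define y where "y = u - e *\<^sub>C x"
    have Ry: "R y = x"
      using resolvent_shift[OF e u] by (simp add: R_def y_def)
    \<comment> \<open>\<open>R\<close> maps 0 to 0, but \<open>y\<close> to the nonzero vector
      \<open>x\<close>.\<close>
    then have y: "y \<noteq> 0"
      using x(1) linear_0[OF linR] by auto
    have "S y = u - z *\<^sub>C x"
      unfolding S_def Ry by (simp add: y_def scaleC_diff_left)
    then have "K y = v"
      using resolvent_shift[OF z u] v by (simp add: K_def K0_def)
    moreover have yv: "y = - t *\<^sub>R v"
      using uv by (simp add: y_def algebra_simps)
    \<comment> \<open>For \<open>t = 0\<close> the vector \<open>y\<close> would vanish:
      \<open>E0\<close> is no eigenvalue of \<open>H0\<close>.\<close>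
    moreover have "t \<noteq> 0"
      using y yv by auto
    ultimately have "K y = (- 1 / t) *\<^sub>R y"
      by simp
    then show ?thesis
      using y \<open>t \<noteq> 0\<close> by blast
  qed
  define A where "A = {t. 0 \<le> t \<and> t \<le> 1 \<and>
    e \<in> point_spectrum (op_add H0 (op_scale (complex_of_real t) V))}"
  \<comment> \<open>Here \<open>0 < t \<le> 1\<close>, so \<open>- 1 / t\<close> has modulus at
    least 1; this is where the bound on \<open>t\<close> enters.\<close>
  have "- 1 / t \<in> {l. 1 \<le> \<bar>l\<bar> \<and> (\<exists>v. v \<noteq> 0 \<and> K v = l *\<^sub>R v)}" if t: "t \<in> A" for t
    using t eig[of t] by (simp add: A_def)
  then have "(\<lambda>t. - 1 / t) ` A \<subseteq> {l. 1 \<le> \<bar>l\<bar> \<and> (\<exists>v. v \<noteq> 0 \<and> K v = l *\<^sub>R v)}"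
    by (rule image_subsetI)
  then have "finite ((\<lambda>t. - 1 / t) ` A)"
    by (rule finite_subset) (rule finite_large_eigenvalues_of_compact[OF linK compK zero_less_one])
  \<comment> \<open>Injectivity holds even across \<open>t = 0\<close>, since \<open>- 1 / 0\<close>
    is 0 and no other value is.\<close>
  moreover have "inj_on (\<lambda>t :: real. - 1 / t) A"
    by (rule inj_onI) simp
  ultimately have "finite A"
    by (rule finite_imageD)
  then show ?thesis
    by (simp add: A_def e_def)
qed

end
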